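(* Let $n\ge1$, $k\ge1$, and let $V:=\{v_1,\ldots,v_m\}$ be a set of points in $\mathbb R^n$. Let $\mathcal F=\{F_1,\ldots,F_m\}$ be a cover of the unit ball $\mathbb B^k$ that is not null-homotopic on the boundary, i.e. the cover $\{F_1\cap\mathbb S^{k-1},\ldots,F_m\cap\mathbb S^{k-1}\}$ of $\mathbb S^{k-1}=\partial\mathbb B^k$ is not null-homotopic with respect to $V$. Then there is a subset $\mathcal B\subset I_m:=\{1,\ldots,m\}$, balanced with respect to $V$, such that $$\bigcap_{i\in\mathcal B}F_i\neq\emptyset .$$
   Context: A cover of a space $T$ is a finite indexed family of subsets whose union is $T$ and which are either all open or all closed in $T$. $[T,Y]$ is the set of homotopy classes of continuous maps $T\to Y$; $[f]\ne 0$ means that $f$ is not homotopic to a constant map. Balanced sets: let $c_V:=\frac1m\sum_{i=1}^m v_i$. A nonempty subset $\mathcal B\subset I_m$ is balanced with respect to $V$ if $c_V\in\operatorname{conv}\{v_i: i\in\mathcal B\}$. Homotopy class of a cover with respect to $V$: let $\mathcal U=\{U_1,\ldots,U_m\}$ be an open cover of a normal space $T$ such that $\bigcap_{i\in\mathcal B}U_i=\emptyset$ for every balanced $\mathcal B$, and let $\{\varphi_1,\ldots,\varphi_m\}$ be a partition of unity with $\operatorname{supp}\varphi_i\subset U_i$. Put $\rho(x)=\sum_{i=1}^m\varphi_i(x)v_i$. Then $\rho(x)\ne c_V$ for all $x\in T$, and $f_{\mathcal U,V}(x)=\frac{\rho(x)-c_V}{\|\rho(x)-c_V\|}$ is a continuous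 map $T\to\mathbb S^{n-1}$ whose homotopy class $\mu(\mathcal U,V)\in[T,\mathbb S^{n-1}]$ does not depend on the partition of unity. For a closed cover $\mathcal S=\{S_1,\ldots,S_m\}$ of $T$ such that $\bigcap_{i\in\mathcal B}S_i=\emptyset$ for every balanced $\mathcal B$, put $\mu(\mathcal S,V):=\mu(\mathcal U,V)$ for any open cover $\mathcal U$ with $S_i\subset U_i$ and $\bigcap_{i\in\mathcal B}U_i=\emptyset$ for every balanced $\mathcal B$ (this does not depend on the choice of $\mathcal U$). A cover $\mathcal S=\{S_1,\ldots,S_m\}$ of $T$ is not null-homotopic with respect to $V$ if $\bigcap_{i\in\mathcal B}S_i=\emptyset$ for every balanced $\mathcal B\subset I_m$ and $\mu(\mathcal S,V)\ne0$ in $[T,\mathbb S^{n-1}]$. *)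

theory Defs
  imports "HOL-Analysis.Analysis"
begin

definition is_cover :: "'a topology \<Rightarrow> nat \<Rightarrow> (nat \<Rightarrow> 'a set) \<Rightarrow> bool" where
  "is_cover X m S \<longleftrightarrow>
     (\<Union>i\<in>{1..m}. S i) = topspace X \<and>
     ((\<forall>i\<in>{1..m}. openin X (S i)) \<or> (\<forall>i\<in>{1..m}. closedin X (S i)))"

definition center :: "nat \<Rightarrow> (nat \<Rightarrow> real^'n) \<Rightarrow> real^'n" where
  "center m v = (1 / real m) *\<^sub>R (\<Sum>i=1..m. v i)"

definition balanced :: "nat \<Rightarrow> (nat \<Rightarrow> real^'n) \<Rightarrow> nat set \<Rightarrow> bool" where
  "balanced m v B \<longleftrightarrow> B \<noteq> {} \<and> B \<subseteq> {1..m} \<and> center m v \<in> convex hull (v ` B)"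

definition no_balanced_intersection ::
    "nat \<Rightarrow> (nat \<Rightarrow> real^'n) \<Rightarrow> (nat \<Rightarrow> 'a set) \<Rightarrow> bool" where
  "no_balanced_intersection m v S \<longleftrightarrow> (\<forall>B. balanced m v B \<longrightarrow> (\<Inter>i\<in>B. S i) = {})"

definition subordinate_partition ::
    "'a topology \<Rightarrow> nat \<Rightarrow> (nat \<Rightarrow> 'a set) \<Rightarrow> (nat \<Rightarrow> 'a \<Rightarrow> real) \<Rightarrow> bool" where
  "subordinate_partition X m U \<phi> \<longleftrightarrow>
     (\<forall>i\<in>{1..m}. continuous_map X euclideanreal (\<phi> i)) \<and>
     (\<forall>i\<in>{1..m}. \<forall>x\<in>topspace X. 0 \<le> \<phi> i x) \<and>
     (\<forall>x\<in>topspace X. (\<Sum>i=1..m. \<phi> i x) = 1) \<and>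
     (\<forall>i\<in>{1..m}. X closure_of {x \<in> topspace X. \<phi> i x \<noteq> 0} \<subseteq> U i)"

definition cover_map ::
    "nat \<Rightarrow> (nat \<Rightarrow> real^'n) \<Rightarrow> (nat \<Rightarrow> 'a \<Rightarrow> real) \<Rightarrow> 'a \<Rightarrow> real^'n" where
  "cover_map m v \<phi> x =
     (let \<rho> = (\<Sum>i=1..m. \<phi> i x *\<^sub>R v i)
      in (\<rho> - center m v) /\<^sub>R norm (\<rho> - center m v))"

definition homotopy_class :: "'a topology \<Rightarrow> 'b topology \<Rightarrow> ('a \<Rightarrow> 'b) \<Rightarrow> ('a \<Rightarrow> 'b) set" where
  "homotopy_class X Y f = {g. homotopic_with (\<lambda>_. True) X Y f g}"

definition null_class :: "'b topology \<Rightarrow> ('a \<Rightarrow> 'b) set \<Rightarrow> bool" where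
  "null_class Y C \<longleftrightarrow> (\<exists>a\<in>topspace Y. (\<lambda>_. a) \<in> C)"

text \<open>
  The choices made with \<open>SOME\<close> in the next two definitions are possible when \<open>X\<close> is normal and
  the given cover has no balanced intersection; the resulting homotopy class does not depend on
  them.
\<close>

definition open_cover_class ::
    "'a topology \<Rightarrow> nat \<Rightarrow> (nat \<Rightarrow> real^'n) \<Rightarrow> (nat \<Rightarrow> 'a set) \<Rightarrow> ('a \<Rightarrow> real^'n) set" where
  "open_cover_class X m v U =
     homotopy_class X (top_of_set (sphere 0 1))
       (cover_map m v (SOME \<phi>. subordinate_partition X m U \<phi>))"

definition closed_cover_class ::
    "'a topology \<Rightarrow> nat \<Rightarrow> (nat \<Rightarrow> real^'n) \<Rightarrow> (nat \<Rightarrow> 'a set) \<Rightarrow> ('a \<Rightarrow> real^'n) set" where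
  "closed_cover_class X m v S =
     open_cover_class X m v
       (SOME U. (\<forall>i\<in>{1..m}. openin X (U i) \<and> S i \<subseteq> U i) \<and> no_balanced_intersection m v U)"

text \<open>
  A cover that is both open and closed may be treated as either: it is then an admissible choice
  of \<open>U\<close> for itself, so both definitions give the same class.
\<close>

definition cover_class ::
    "'a topology \<Rightarrow> nat \<Rightarrow> (nat \<Rightarrow> real^'n) \<Rightarrow> (nat \<Rightarrow> 'a set) \<Rightarrow> ('a \<Rightarrow> real^'n) set" where
  "cover_class X m v S =
     (if \<forall>i\<in>{1..m}. openin X (S i) then open_cover_class X m v S else closed_cover_class X m v S)"

definition not_null_homotopic ::
    "'a topology \<Rightarrow> nat \<Rightarrow> (nat \<Rightarrow> real^'n) \<Rightarrow> (nat \<Rightarrow> 'a set) \<Rightarrow> bool" where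
  "not_null_homotopic X m v S \<longleftrightarrow>
     is_cover X m S \<and> no_balanced_intersection m v S \<and>
     \<not> null_class (top_of_set (sphere (0::real^'n) 1)) (cover_class X m v S)"

end

theory Submission
  imports Defs
begin

text \<open>
  Suppose that no balanced intersection of the cover of the ball is nonempty.  The cover can then
  be enlarged to an open cover \<open>W\<close> of the ball that still has no balanced intersection, and a
  partition of unity \<open>\<phi>\<close> subordinate to \<open>W\<close> gives a map \<open>\<rho> = (\<Sum>i. \<phi> i *\<^sub>R v i)\<close> that avoids the
  center: if \<open>\<rho> x\<close> were the center, the indices with \<open>\<phi> i x \<noteq> 0\<close> would form a balanced set
  whose members \<open>W i\<close> all contain \<open>x\<close> (\<open>convex_combination_neq_center\<close>).  So
  \<open>cover_map m v \<phi>\<close> is defined on the whole ball, and since the ball is contractible, its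
  restriction to the boundary sphere is homotopic to a constant.

  The restriction represents the class of the boundary cover.  That class is defined by an
  open enlargement \<open>U\<close> of the boundary cover and a partition of unity, both chosen
  independently of \<open>W\<close> and \<open>\<phi>\<close>.  Two partitions of unity subordinate to one and the same
  open cover without balanced intersection give homotopic maps, because the segment from
  one \<open>\<rho>\<close> to the other consists of further such convex combinations
  (\<open>cover_map_homotopic\<close>).  A partition of unity subordinate to
  \<open>\<lambda>i. U i \<inter> W i\<close> is subordinate to both enlargements, and so links
  the two maps by two homotopies.

  The open enlargements and the partitions of unity exist because the ball and the sphere
  are normal spaces; both constructions rest on
  \<open>normal_space_swelling\<close>.
\<close>

section \<open>Swellings and partitions of unity in normal spaces\<close>

text \<open>
  One set is enlarged at a time.  To enlarge \<open>C i\<close>, consider every intersection of the other sets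
  of a subfamily in \<open>K\<close> containing \<open>i\<close>.  There are finitely many of them, each is closed, and
  none meets \<open>C i\<close>; normality separates \<open>C i\<close> from their union, and the closure of the
  neighbourhood obtained replaces \<open>C i\<close>.  Each set ends up with an open set \<open>N i\<close> and a
  closed set \<open>G i\<close> around it because the dual statement \<open>normal_space_shrinking\<close> needs both.
  Intersecting with \<open>topspace X\<close> gives the empty subfamily its proper meaning.
\<close>

lemma normal_space_swelling:
  assumes X: "normal_space X" and fin: "finite I" and K: "K \<subseteq> Pow I"
    and C: "\<And>i. i \<in> I \<Longrightarrow> closedin X (C i)"
    and disj: "\<And>B. B \<in> K \<Longrightarrow> topspace X \<inter> (\<Inter>i\<in>B. C i) = {}"
  obtains N G where "\<And>i. i \<in> I \<Longrightarrow> openin X (N i)" "\<And>i. i \<in> I \<Longrightarrow> closedin X (G i)"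
    "\<And>i. i \<in> I \<Longrightarrow> C i \<subseteq> N i" "\<And>i. i \<in> I \<Longrightarrow> N i \<subseteq> G i"
    "\<And>B. B \<in> K \<Longrightarrow> topspace X \<inter> (\<Inter>i\<in>B. G i) = {}"
proof -
  have "\<exists>N G. (\<forall>i\<in>J. openin X (N i) \<and> C i \<subseteq> N i \<and> N i \<subseteq> G i) \<and> (\<forall>i\<in>I-J. G i = C i) \<and>
          (\<forall>i\<in>I. closedin X (G i)) \<and> (\<forall>B\<in>K. topspace X \<inter> (\<Inter>i\<in>B. G i) = {})"
    if "finite J" "J \<subseteq> I" for J
    using that
  proof (induction J rule: finite_induct)
    case empty
    show ?case by (rule exI[of _ C], rule exI[of _ C]) (use C disj in auto)
  next
    case (insert k J)
    then obtain N G where N: "\<forall>i\<in>J. openin X (N i) \<and> C i \<subseteq> N i \<and> N i \<subseteq> G i"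
      and GC: "\<forall>i\<in>I-J. G i = C i" and G: "\<forall>i\<in>I. closedin X (G i)"
      and Gdisj: "\<forall>B\<in>K. topspace X \<inter> (\<Inter>i\<in>B. G i) = {}"
      by auto
    have k: "k \<in> I" "k \<notin> J" "G k = C k" using insert GC by auto
    define R where "R B = topspace X \<inter> (\<Inter>j\<in>B-{k}. G j)" for B
    define D where "D = (\<Union>B\<in>{B\<in>K. k \<in> B}. R B)"
    have "closedin X (R B)" if "B \<in> K" for B
    proof (cases "B - {k} = {}")
      case True
      then show ?thesis unfolding R_def True by simp
    next
      case False
      then show ?thesis unfolding R_def using that K G by (intro closedin_Int closedin_INT) auto
    qed
    moreover have "finite K" using K fin by (simp add: finite_subset)
    ultimately have "closedin X D" unfolding D_def by (intro closedin_Union) auto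
    moreover have "C k \<inter> D = {}"
      using Gdisj k(3) unfolding D_def R_def by fastforce
    ultimately have "openin X (topspace X - D)" "C k \<subseteq> topspace X - D"
      using closedin_subset[OF C[OF k(1)]] by auto
    then obtain M where M: "openin X M" "C k \<subseteq> M" "X closure_of M \<subseteq> topspace X - D"
      using X C[OF k(1)] unfolding normal_space_alt by meson
    let ?N = "N(k := M)" and ?G = "G(k := X closure_of M)"
    have "topspace X \<inter> (\<Inter>i\<in>B. ?G i) = {}" if B: "B \<in> K" for B
    proof (cases "k \<in> B")
      case True
      then have "topspace X \<inter> (\<Inter>i\<in>B. ?G i) \<subseteq> X closure_of M \<inter> R B"
        unfolding R_def by auto
      also have "\<dots> \<subseteq> {}" using M(3) True B unfolding D_def by auto
      finally show ?thesis by simp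
    next
      case False
      then have "(\<Inter>i\<in>B. ?G i) = (\<Inter>i\<in>B. G i)" by (intro INF_cong) auto
      then show ?thesis using Gdisj B by simp
    qed
    moreover have "\<forall>i\<in>insert k J. openin X (?N i) \<and> C i \<subseteq> ?N i \<and> ?N i \<subseteq> ?G i"
      using N M closure_of_subset[OF openin_subset[OF M(1)]] by auto
    ultimately show ?case
      using GC G by (intro exI[of _ ?N] exI[of _ ?G]) auto
  qed
  from this[OF fin order_refl] obtain N G
    where "\<forall>i\<in>I. openin X (N i) \<and> C i \<subseteq> N i \<and> N i \<subseteq> G i"
      "\<forall>i\<in>I. closedin X (G i)" "\<forall>B\<in>K. topspace X \<inter> (\<Inter>i\<in>B. G i) = {}"
    by (elim exE conjE)
  then show ?thesis by (intro that[of N G]) simp_all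
qed

text \<open>
  The complements of an open cover are closed sets with empty intersection; swelling them and
  taking complements again shrinks the cover.
\<close>

lemma normal_space_shrinking:
  assumes X: "normal_space X" and fin: "finite I"
    and U: "\<And>i. i \<in> I \<Longrightarrow> openin X (U i)" and cover: "topspace X \<subseteq> (\<Union>i\<in>I. U i)"
  obtains V H where "\<And>i. i \<in> I \<Longrightarrow> openin X (V i)" "\<And>i. i \<in> I \<Longrightarrow> closedin X (H i)"
    "\<And>i. i \<in> I \<Longrightarrow> V i \<subseteq> H i" "\<And>i. i \<in> I \<Longrightarrow> H i \<subseteq> U i" "topspace X \<subseteq> (\<Union>i\<in>I. V i)"
proof -
  obtain N G where NG: "\<And>i. i \<in> I \<Longrightarrow> openin X (N i)" "\<And>i. i \<in> I \<Longrightarrow> closedin X (G i)"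
    "\<And>i. i \<in> I \<Longrightarrow> topspace X - U i \<subseteq> N i" "\<And>i. i \<in> I \<Longrightarrow> N i \<subseteq> G i"
    "\<And>B. B \<in> {I} \<Longrightarrow> topspace X \<inter> (\<Inter>i\<in>B. G i) = {}"
  proof (rule normal_space_swelling[OF X fin, of "{I}" "\<lambda>i. topspace X - U i"])
    show "topspace X \<inter> (\<Inter>i\<in>B. topspace X - U i) = {}" if "B \<in> {I}" for B
      using that cover by auto
  qed (use U in auto)
  show ?thesis
  proof (rule that[of "\<lambda>i. topspace X - G i" "\<lambda>i. topspace X - N i"])
    show "topspace X \<subseteq> (\<Union>i\<in>I. topspace X - G i)"
      using NG(5)[of I] by auto
  qed (use NG(1-4) in \<open>auto, blast\<close>)
qed

text \<open>
  Two shrinkings \<open>V' \<subseteq> H' \<subseteq> V \<subseteq> H \<subseteq> U\<close> are used: a Urysohn function that is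
  \<open>1\<close> on \<open>H'\<close> and \<open>0\<close> outside \<open>V\<close> has the closure of its support inside \<open>H\<close>.  The sum of these
  functions is positive since \<open>V'\<close> is a cover.
\<close>

lemma subordinate_partition_exists:
  assumes X: "normal_space X"
    and U: "\<And>i. i \<in> {1..m} \<Longrightarrow> openin X (U i)" and cover: "topspace X \<subseteq> (\<Union>i\<in>{1..m}. U i)"
  obtains \<phi> where "subordinate_partition X m U \<phi>"
proof -
  obtain V H where V: "\<And>i. i \<in> {1..m} \<Longrightarrow> openin X (V i)" "\<And>i. i \<in> {1..m} \<Longrightarrow> closedin X (H i)"
    "\<And>i. i \<in> {1..m} \<Longrightarrow> V i \<subseteq> H i" "\<And>i. i \<in> {1..m} \<Longrightarrow> H i \<subseteq> U i" "topspace X \<subseteq> (\<Union>i\<in>{1..m}. V i)"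
    by (rule normal_space_shrinking[OF X finite_atLeastAtMost U cover]) (assumption | rule that)+
  obtain V' H' where V': "\<And>i. i \<in> {1..m} \<Longrightarrow> openin X (V' i)" "\<And>i. i \<in> {1..m} \<Longrightarrow> closedin X (H' i)"
    "\<And>i. i \<in> {1..m} \<Longrightarrow> V' i \<subseteq> H' i" "\<And>i. i \<in> {1..m} \<Longrightarrow> H' i \<subseteq> V i" "topspace X \<subseteq> (\<Union>i\<in>{1..m}. V' i)"
    by (rule normal_space_shrinking[OF X finite_atLeastAtMost V(1,5)]) (assumption | rule that)+
  have "\<exists>g. continuous_map X (top_of_set {0..1::real}) g \<and>
          g ` (topspace X - V i) \<subseteq> {0} \<and> g ` H' i \<subseteq> {1}" if "i \<in> {1..m}" for i
  proof -
    have "disjnt (topspace X - V i) (H' i)" using V'(4)[OF that] by (auto simp: disjnt_def)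
    then show ?thesis
      using Urysohn_lemma[OF X, of "topspace X - V i" "H' i" 0 "1::real"] V(1)[OF that] V'(2)[OF that]
      by (metis closedin_diff closedin_topspace zero_le_one)
  qed
  then obtain g where g: "\<And>i. i \<in> {1..m} \<Longrightarrow> continuous_map X (top_of_set {0..1::real}) (g i) \<and>
          g i ` (topspace X - V i) \<subseteq> {0} \<and> g i ` H' i \<subseteq> {1}"
    by metis
  have cont: "continuous_map X euclideanreal (g i)" if "i \<in> {1..m}" for i
    using g[OF that] by (simp add: continuous_map_in_subtopology)
  have nonneg: "0 \<le> g i x" if "i \<in> {1..m}" "x \<in> topspace X" for i x
    using g[OF that(1)] that(2) by (auto simp: continuous_map_in_subtopology Pi_iff)
  define s where "s x = (\<Sum>i=1..m. g i x)" for x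
  have pos: "0 < s x" if x: "x \<in> topspace X" for x
  proof -
    obtain i where i: "i \<in> {1..m}" "x \<in> H' i" using V' x by blast
    then have "g i x = 1" using g by blast
    then show ?thesis unfolding s_def using i x nonneg by (intro sum_pos2[of _ i]) auto
  qed
  have conts: "continuous_map X euclideanreal s"
    unfolding s_def using cont by (intro continuous_map_sum) auto
  have "subordinate_partition X m U (\<lambda>i x. g i x / s x)"
    unfolding subordinate_partition_def
  proof (intro conjI ballI)
    fix i assume i: "i \<in> {1..m}"
    show "continuous_map X euclideanreal (\<lambda>x. g i x / s x)"
      using cont[OF i] conts pos by (intro continuous_map_real_divide) force+
    show "0 \<le> g i x / s x" if "x \<in> topspace X" for x
      using nonneg[OF i that] pos[OF that] by simp
    have "{x \<in> topspace X. g i x / s x \<noteq> 0} \<subseteq> H i" using g[OF i] V(3)[OF i] by auto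
    then show "X closure_of {x \<in> topspace X. g i x / s x \<noteq> 0} \<subseteq> U i"
      using V(2,4)[OF i] closure_of_minimal by blast
  next
    fix x assume "x \<in> topspace X"
    then show "(\<Sum>i=1..m. g i x / s x) = 1"
      using pos[of x] by (simp add: s_def flip: sum_divide_distrib)
  qed
  then show ?thesis using that by blast
qed

lemma normal_space_top_of_set: "normal_space (top_of_set (S :: 'a::metric_space set))"
  by (simp add: metrizable_imp_normal_space metrizable_space_euclidean metrizable_space_subtopology)

lemma subordinate_partition_support:
  assumes "subordinate_partition X m U \<phi>" "i \<in> {1..m}" "x \<in> topspace X" "\<phi> i x \<noteq> 0"
  shows "x \<in> U i"
proof -
  have "x \<in> X closure_of {x \<in> topspace X. \<phi> i x \<noteq> 0}"
    using assms closure_of_subset[of "{x \<in> topspace X. \<phi> i x \<noteq> 0}" X] by auto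
  then show ?thesis using assms unfolding subordinate_partition_def by blast
qed

lemma subordinate_partition_mono:
  assumes "subordinate_partition X m U \<phi>" "\<And>i. i \<in> {1..m} \<Longrightarrow> U i \<subseteq> W i"
  shows "subordinate_partition X m W \<phi>"
  using assms unfolding subordinate_partition_def by blast

lemma subordinate_partition_subset:
  assumes \<phi>: "subordinate_partition (top_of_set T) m W \<phi>" and "S \<subseteq> T"
  shows "subordinate_partition (top_of_set S) m (\<lambda>i. W i \<inter> S) \<phi>"
proof -
  have "top_of_set S closure_of {x \<in> S. \<phi> i x \<noteq> 0} \<subseteq> W i \<inter> S" if "i \<in> {1..m}" for i
  proof -
    have "top_of_set S = subtopology (top_of_set T) S"
      using \<open>S \<subseteq> T\<close> by (simp add: subtopology_subtopology inf.absorb2)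
    then have *: "top_of_set S closure_of {x \<in> S. \<phi> i x \<noteq> 0}
        \<subseteq> top_of_set T closure_of {x \<in> T. \<phi> i x \<noteq> 0} \<inter> S"
      using \<open>S \<subseteq> T\<close> closure_of_mono[of "{x \<in> S. \<phi> i x \<noteq> 0}" "{x \<in> T. \<phi> i x \<noteq> 0}" "top_of_set T"]
        closure_of_subtopology_subset[of "top_of_set T" S "{x \<in> S. \<phi> i x \<noteq> 0}"]
        closure_of_subset_topspace[of "top_of_set S"]
      by fastforce
    have "top_of_set T closure_of {x \<in> T. \<phi> i x \<noteq> 0} \<subseteq> W i"
      using \<phi> that unfolding subordinate_partition_def by simp
    with * show ?thesis by blast
  qed
  then show ?thesis
    using \<phi> unfolding subordinate_partition_def
    by (auto simp: subsetD[OF \<open>S \<subseteq> T\<close>] intro: continuous_on_subset[OF _ \<open>S \<subseteq> T\<close>])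
qed

section \<open>The map of a cover without balanced intersection\<close>

text \<open>
  A cover that is not open is closed, and then a swelling of it with respect to the balanced
  index sets is open.
\<close>

lemma open_enlargement_exists:
  assumes X: "normal_space X" and S: "is_cover X m S" and nb: "no_balanced_intersection m v S"
  obtains U where "\<And>i. i \<in> {1..m} \<Longrightarrow> openin X (U i)" "\<And>i. i \<in> {1..m} \<Longrightarrow> S i \<subseteq> U i"
    "no_balanced_intersection m v U"
proof (cases "\<forall>i\<in>{1..m}. openin X (S i)")
  case True
  then show ?thesis using that[of S] nb by auto
next
  case False
  then have closed: "\<And>i. i \<in> {1..m} \<Longrightarrow> closedin X (S i)" using S unfolding is_cover_def by blast
  let ?K = "{B. balanced m v B}"
  obtain N G where NG: "\<And>i. i \<in> {1..m} \<Longrightarrow> openin X (N i)" "\<And>i. i \<in> {1..m} \<Longrightarrow> S i \<subseteq> N i"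
    "\<And>i. i \<in> {1..m} \<Longrightarrow> N i \<subseteq> G i" "\<And>B. B \<in> ?K \<Longrightarrow> topspace X \<inter> (\<Inter>i\<in>B. G i) = {}"
  proof (rule normal_space_swelling[OF X, of "{1..m}" ?K S])
    show "topspace X \<inter> (\<Inter>i\<in>B. S i) = {}" if "B \<in> ?K" for B
      using nb that unfolding no_balanced_intersection_def by blast
  qed (use closed in \<open>auto simp: balanced_def\<close>)
  have "(\<Inter>i\<in>B. N i) = {}" if B: "balanced m v B" for B
  proof -
    have "B \<noteq> {}" "B \<subseteq> {1..m}" using B unfolding balanced_def by auto
    then have "(\<Inter>i\<in>B. N i) \<subseteq> topspace X" "(\<Inter>i\<in>B. N i) \<subseteq> (\<Inter>i\<in>B. G i)"
      using openin_subset[OF NG(1)] NG(3) by blast+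
    then show ?thesis using NG(4)[of B] B by blast
  qed
  then show ?thesis using that[of N] NG unfolding no_balanced_intersection_def by blast
qed

text \<open>
  If the combination were the center, the indices of nonzero weight would be balanced, and \<open>x\<close>
  would lie in the corresponding intersection.
\<close>

lemma convex_combination_neq_center:
  assumes nb: "no_balanced_intersection m v U"
    and w: "\<And>i. i \<in> {1..m} \<Longrightarrow> 0 \<le> w i" "(\<Sum>i=1..m. w i) = 1"
    and U: "\<And>i. i \<in> {1..m} \<Longrightarrow> w i \<noteq> 0 \<Longrightarrow> x \<in> U i"
  shows "(\<Sum>i=1..m. w i *\<^sub>R v i) \<noteq> center m v"
proof
  assume eq: "(\<Sum>i=1..m. w i *\<^sub>R v i) = center m v"
  define B where "B = {i\<in>{1..m}. w i \<noteq> 0}"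
  have sum1: "(\<Sum>i\<in>B. w i) = 1"
    using w(2) unfolding B_def by (subst sum.mono_neutral_left[of "{1..m}"]) auto
  have "(\<Sum>i\<in>B. w i *\<^sub>R v i) = center m v"
    unfolding eq[symmetric] B_def by (intro sum.mono_neutral_left) auto
  moreover have "(\<Sum>i\<in>B. w i *\<^sub>R v i) \<in> convex hull (v ` B)"
    using sum1 w(1) by (intro convex_sum convex_convex_hull) (auto simp: B_def hull_inc)
  moreover have "B \<noteq> {}" using sum1 by auto
  ultimately have "balanced m v B" unfolding balanced_def B_def by auto
  then have "(\<Inter>i\<in>B. U i) = {}" using nb unfolding no_balanced_intersection_def by blast
  moreover have "x \<in> (\<Inter>i\<in>B. U i)" using U unfolding B_def by auto
  ultimately show False by blast
qed

text \<open>
  At each point the segment between the two unnormalised maps consists of convex combinations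
  whose weights are supported where both partitions of unity allow, so it misses the center.
  The straight-line homotopy then takes place in the complement of the center and can be
  normalised.
\<close>

lemma cover_map_homotopic:
  fixes v :: "nat \<Rightarrow> real^'n"
  assumes nb: "no_balanced_intersection m v U"
    and \<phi>: "subordinate_partition (top_of_set S) m U \<phi>"
    and \<psi>: "subordinate_partition (top_of_set S) m U \<psi>"
  shows "homotopic_with_canon (\<lambda>_. True) S (sphere 0 1) (cover_map m v \<phi>) (cover_map m v \<psi>)"
proof -
  define r where "r \<eta> x = (\<Sum>i=1..m. \<eta> i x *\<^sub>R v i) - center m v" for \<eta> :: "nat \<Rightarrow> 'a \<Rightarrow> real" and x
  have cont: "continuous_on S (r \<eta>)" if "subordinate_partition (top_of_set S) m U \<eta>" for \<eta>
    using that unfolding r_def subordinate_partition_def by (intro continuous_intros) auto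
  have "homotopic_with_canon (\<lambda>_. True) S (- {0}) (r \<phi>) (r \<psi>)"
  proof (intro homotopic_with_linear cont \<phi> \<psi>)
    fix x assume x: "x \<in> S"
    show "closed_segment (r \<phi> x) (r \<psi> x) \<subseteq> - {0}"
    proof
      fix y assume "y \<in> closed_segment (r \<phi> x) (r \<psi> x)"
      then obtain t where t: "0 \<le> t" "t \<le> 1" and y: "y = (1 - t) *\<^sub>R r \<phi> x + t *\<^sub>R r \<psi> x"
        unfolding closed_segment_def by auto
      define w where "w i = (1 - t) * \<phi> i x + t * \<psi> i x" for i
      have "y = (\<Sum>i=1..m. w i *\<^sub>R v i) - center m v"
        unfolding y r_def w_def
        by (simp add: algebra_simps sum.distrib scaleR_sum_right sum_subtractf)
      moreover have "(\<Sum>i=1..m. w i *\<^sub>R v i) \<noteq> center m v"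
      proof (rule convex_combination_neq_center[OF nb])
        show "0 \<le> w i" if "i \<in> {1..m}" for i
          using \<phi> \<psi> t x that unfolding w_def subordinate_partition_def by simp
        show "(\<Sum>i=1..m. w i) = 1"
          using \<phi> \<psi> x unfolding w_def subordinate_partition_def
          by (simp add: sum.distrib flip: sum_distrib_left)
        show "x \<in> U i" if "i \<in> {1..m}" "w i \<noteq> 0" for i
        proof -
          have "\<phi> i x \<noteq> 0 \<or> \<psi> i x \<noteq> 0" using that(2) unfolding w_def by auto
          then show ?thesis
            using subordinate_partition_support[OF \<phi> that(1)] subordinate_partition_support[OF \<psi> that(1)] x
            by auto
        qed
      qed
      ultimately show "y \<in> - {0}" by simp
    qed
  qed
  moreover have "continuous_map (top_of_set (- {0 :: real^'n})) (top_of_set (sphere 0 1)) (\<lambda>y. y /\<^sub>R norm y)"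
    by (auto simp: continuous_map_in_subtopology intro!: continuous_intros)
  ultimately have "homotopic_with_canon (\<lambda>_. True) S (sphere 0 1)
      ((\<lambda>y. y /\<^sub>R norm y) \<circ> r \<phi>) ((\<lambda>y. y /\<^sub>R norm y) \<circ> r \<psi>)"
    by (rule homotopic_with_compose_continuous_map_left) simp
  moreover have "(\<lambda>y. y /\<^sub>R norm y) \<circ> r \<eta> = cover_map m v \<eta>" for \<eta>
    by (simp add: fun_eq_iff r_def cover_map_def Let_def)
  ultimately show ?thesis by simp
qed

text \<open>
  This replaces the choices in the definition of the class of a cover by an open
  enlargement and a partition of unity with their expected properties.  A cover that is open is
  its own enlargement.
\<close>

lemma cover_class_representative:
  assumes X: "normal_space X" and S: "is_cover X m S" and nb: "no_balanced_intersection m v S"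
  obtains U \<phi> where "\<And>i. i \<in> {1..m} \<Longrightarrow> openin X (U i)" "\<And>i. i \<in> {1..m} \<Longrightarrow> S i \<subseteq> U i"
    "no_balanced_intersection m v U" "subordinate_partition X m U \<phi>"
    "cover_class X m v S = homotopy_class X (top_of_set (sphere 0 1)) (cover_map m v \<phi>)"
proof -
  let ?P = "\<lambda>U. (\<forall>i\<in>{1..m}. openin X (U i) \<and> S i \<subseteq> U i) \<and> no_balanced_intersection m v U"
  have "\<exists>U. ?P U" by (rule open_enlargement_exists[OF X S nb]) blast
  then have "?P (SOME U. ?P U)" by (rule someI_ex)
  then obtain U where U: "?P U" and class_U: "cover_class X m v S = open_cover_class X m v U"
    using nb unfolding cover_class_def closed_cover_class_def by (metis (no_types, lifting) order_refl)
  have "topspace X \<subseteq> (\<Union>i\<in>{1..m}. U i)" using S U unfolding is_cover_def by blast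
  then obtain \<phi> where "subordinate_partition X m U \<phi>"
    using subordinate_partition_exists[OF X, of m U] U by blast
  then have "subordinate_partition X m U (SOME \<phi>. subordinate_partition X m U \<phi>)"
    by (rule someI[of "subordinate_partition X m U"])
  then show ?thesis using that U class_U unfolding open_cover_class_def by blast
qed

section \<open>Covers that extend over a contractible set\<close>

text \<open>
  The map of the large cover is defined on all of \<open>T\<close> and null-homotopic there; over \<open>S\<close> it is
  linked to the chosen representative through a partition of unity subordinate to the
  common refinement of the two open enlargements.
\<close>

lemma null_class_cover_class_restrict:
  fixes v :: "nat \<Rightarrow> real^'n" and T :: "'a::real_normed_vector set"
  assumes T: "contractible T" "T \<noteq> {}" and "S \<subseteq> T"
    and F: "is_cover (top_of_set T) m F" and nb: "no_balanced_intersection m v F"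
    and FS: "is_cover (top_of_set S) m (\<lambda>i. F i \<inter> S)"
  shows "null_class (top_of_set (sphere 0 1)) (cover_class (top_of_set S) m v (\<lambda>i. F i \<inter> S))"
proof -
  let ?h = "\<lambda>S. homotopic_with_canon (\<lambda>_. True) S (sphere (0 :: real^'n) 1)"
  have nbS: "no_balanced_intersection m v (\<lambda>i. F i \<inter> S)"
    unfolding no_balanced_intersection_def
  proof (intro allI impI)
    fix B assume "balanced m v B"
    then have "(\<Inter>i\<in>B. F i) = {}" using nb unfolding no_balanced_intersection_def by blast
    then show "(\<Inter>i\<in>B. F i \<inter> S) = {}" by blast
  qed
  obtain W where W: "\<And>i. i \<in> {1..m} \<Longrightarrow> openin (top_of_set T) (W i)" "\<And>i. i \<in> {1..m} \<Longrightarrow> F i \<subseteq> W i"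
      "no_balanced_intersection m v W"
    by (rule open_enlargement_exists[OF normal_space_top_of_set F nb]) (assumption | rule that)+
  have "topspace (top_of_set T) \<subseteq> (\<Union>i\<in>{1..m}. W i)" using F W(2) unfolding is_cover_def by blast
  from subordinate_partition_exists[OF normal_space_top_of_set W(1) this]
  obtain \<phi> where \<phi>: "subordinate_partition (top_of_set T) m W \<phi>" by blast
  obtain U \<psi> where U: "\<And>i. i \<in> {1..m} \<Longrightarrow> openin (top_of_set S) (U i)"
      "\<And>i. i \<in> {1..m} \<Longrightarrow> F i \<inter> S \<subseteq> U i" "no_balanced_intersection m v U"
    and \<psi>: "subordinate_partition (top_of_set S) m U \<psi>"
    and class_\<psi>: "cover_class (top_of_set S) m v (\<lambda>i. F i \<inter> S) =
      homotopy_class (top_of_set S) (top_of_set (sphere 0 1)) (cover_map m v \<psi>)"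
    by (rule cover_class_representative[OF normal_space_top_of_set FS nbS]) (assumption | rule that)+
  obtain \<eta> where \<eta>: "subordinate_partition (top_of_set S) m (\<lambda>i. U i \<inter> W i) \<eta>"
  proof (rule subordinate_partition_exists[OF normal_space_top_of_set])
    fix i assume i: "i \<in> {1..m}"
    have "openin (top_of_set S) (W i \<inter> S)"
      using W(1)[OF i] \<open>S \<subseteq> T\<close> by (auto simp: openin_open)
    moreover have "U i \<inter> W i = U i \<inter> (W i \<inter> S)"
      using openin_subset[OF U(1)[OF i]] by auto
    ultimately show "openin (top_of_set S) (U i \<inter> W i)" using U(1)[OF i] by auto
  next
    show "topspace (top_of_set S) \<subseteq> (\<Union>i\<in>{1..m}. U i \<inter> W i)"
    proof
      fix x assume "x \<in> topspace (top_of_set S)"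
      then obtain i where "i \<in> {1..m}" "x \<in> F i \<inter> S" using FS unfolding is_cover_def by blast
      then show "x \<in> (\<Union>i\<in>{1..m}. U i \<inter> W i)" using U(2) W(2) by blast
    qed
  qed
  have "?h S (cover_map m v \<psi>) (cover_map m v \<eta>)"
    by (rule cover_map_homotopic[OF U(3) \<psi> subordinate_partition_mono[OF \<eta>]]) auto
  moreover have "?h S (cover_map m v \<eta>) (cover_map m v \<phi>)"
  proof (rule cover_map_homotopic[OF W(3) subordinate_partition_mono[OF \<eta>]])
    show "subordinate_partition (top_of_set S) m W \<phi>"
      by (rule subordinate_partition_mono[OF subordinate_partition_subset[OF \<phi> \<open>S \<subseteq> T\<close>]]) auto
  qed auto
  moreover obtain c where c: "?h T (cover_map m v \<phi>) (\<lambda>_. c)"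
  proof -
    \<comment> \<open>A homotopy from the map to itself records that it is continuous into the sphere.\<close>
    have "?h T (cover_map m v \<phi>) (cover_map m v \<phi>)"
      by (rule cover_map_homotopic[OF W(3) \<phi> \<phi>])
    then have "continuous_map (top_of_set T) (top_of_set (sphere 0 1)) (cover_map m v \<phi>)"
      by (simp only: homotopic_with_refl)
    then have "continuous_on T (cover_map m v \<phi>)" "cover_map m v \<phi> \<in> T \<rightarrow> sphere 0 1"
      by (simp_all add: continuous_map_in_subtopology image_subset_iff_funcset)
    then show ?thesis using nullhomotopic_from_contractible[OF _ _ T(1)] that by blast
  qed
  ultimately have "?h S (cover_map m v \<psi>) (\<lambda>_. c)"
    using homotopic_with_subset_left[OF c \<open>S \<subseteq> T\<close>] by (blast intro: homotopic_with_trans)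
  moreover have "c \<in> sphere 0 1"
    using homotopic_with_imp_subset2[OF c] T(2) by auto
  ultimately show ?thesis
    unfolding class_\<psi> null_class_def homotopy_class_def by auto
qed

theorem corollary4p1:
  fixes v :: "nat \<Rightarrow> real^'n" and F :: "nat \<Rightarrow> (real^'k) set" and m :: nat
  assumes "is_cover (top_of_set (cball 0 1)) m F"
    and "not_null_homotopic (top_of_set (sphere 0 1)) m v (\<lambda>i. F i \<inter> sphere 0 1)"
  shows "\<exists>B. balanced m v B \<and> (\<Inter>i\<in>B. F i) \<noteq> {}"
proof (rule ccontr)
  assume "\<not> ?thesis"
  then have "no_balanced_intersection m v F"
    unfolding no_balanced_intersection_def by blast
  then have "null_class (top_of_set (sphere 0 1))
      (cover_class (top_of_set (sphere 0 1)) m v (\<lambda>i. F i \<inter> sphere 0 1))"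
    using assms by (intro null_class_cover_class_restrict[of "cball 0 1"])
      (auto simp: not_null_homotopic_def convex_imp_contractible)
  then show False
    using assms(2) unfolding not_null_homotopic_def by blast
qed

end
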